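(* Let $l\ge 1$, let $z_1,\dots,z_l>0$, and let $\{Y_n^{(1)}\}_{n\ge 1},\dots,\{Y_n^{(l)}\}_{n\ge 1}$ be mutually independent stationary sequences of random variables with regularly varying stationary distributions having tail indices $k_1,\dots,k_l>0$, respectively, i.e. $P\{Y_n^{(i)}>x\}\sim c^{(i)}x^{-k_i}$ as $x\to\infty$ with constants $c^{(i)}>0$, and having extremal indices $\theta_1,\dots,\theta_l$, respectively. Suppose that for some $m\in\{1,\dots,l\}$ one has $k_m<k_i$ for all $i\in\{1,\dots,l\}$ with $i\neq m$. Put $$Y_n^*(z)=\max\left(z_1Y_n^{(1)},z_2Y_n^{(2)},\dots,z_lY_n^{(l)}\right),\qquad Y_n(z)=z_1Y_n^{(1)}+z_2Y_n^{(2)}+\dots+z_lY_n^{(l)},\qquad n\ge 1.$$ Then $\{Y_n^*(z)\}_{n\ge1}$ and $\{Y_n(z)\}_{n\ge1}$ have the same tail index $k(z)=k_m$ and the same extremal index $\theta(z)=\theta_m$.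
   Context: Tail index: a stationary sequence $\{R_n\}_{n\ge1}$ (or its stationary distribution) has tail index $k>0$ if $P\{R_n>x\}\sim c\,x^{-k}$ as $x\to\infty$ for some real constant $c>0$. Extremal index: let $\{R_n\}_{n\ge 1}$ be a stationary sequence with marginal distribution function $F$ and partial maxima $M_n=\max_{1\le j\le n}R_j$. It is said to have extremal index $\theta\in[0,1]$ if for each $0<\tau<\infty$ there is a sequence of real numbers $u_n=u_n(\tau)$ such that $\lim_{n\to\infty}n(1-F(u_n))=\tau$ and $\lim_{n\to\infty}P\{M_n\le u_n\}=e^{-\tau\theta}$. *)

theory Defs
  imports "HOL-Probability.Probability" "HOL-Library.Landau_Symbols"
begin

text \<open>
  Sequences are indexed by \<open>n \<ge> 1\<close>; the term at index \<open>0\<close> plays no role anywhere.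
  Stationarity is meant in the strict sense: all finite-dimensional distributions are
  invariant under shifts of the index.
\<close>

definition stationary_seq :: "'a measure \<Rightarrow> (nat \<Rightarrow> 'a \<Rightarrow> real) \<Rightarrow> bool" where
  "stationary_seq M R \<longleftrightarrow>
     (\<forall>n\<ge>1. R n \<in> borel_measurable M) \<and>
     (\<forall>h J. finite J \<and> J \<subseteq> {1..} \<longrightarrow>
        distr M (Pi\<^sub>M J (\<lambda>_. borel)) (\<lambda>\<omega>. \<lambda>j\<in>J. R (j + h) \<omega>) =
        distr M (Pi\<^sub>M J (\<lambda>_. borel)) (\<lambda>\<omega>. \<lambda>j\<in>J. R j \<omega>))"

text \<open>
  Having a tail index or an extremal index includes being stationary.
\<close>

definition has_tail_index :: "'a measure \<Rightarrow> (nat \<Rightarrow> 'a \<Rightarrow> real) \<Rightarrow> real \<Rightarrow> bool" where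
  "has_tail_index M R k \<longleftrightarrow>
     stationary_seq M R \<and> k > 0 \<and>
     (\<exists>c>0. \<forall>n\<ge>1.
        (\<lambda>x. measure M {\<omega> \<in> space M. R n \<omega> > x}) \<sim>[at_top] (\<lambda>x. c * x powr (- k)))"

definition partial_max :: "(nat \<Rightarrow> 'a \<Rightarrow> real) \<Rightarrow> nat \<Rightarrow> 'a \<Rightarrow> real" where
  "partial_max R n \<omega> = Max ((\<lambda>j. R j \<omega>) ` {1..n})"

text \<open>
  The marginal distribution function is that of \<open>R 1\<close>; by stationarity it is that of
  every \<open>R n\<close> with \<open>n \<ge> 1\<close>.
\<close>

definition has_extremal_index :: "'a measure \<Rightarrow> (nat \<Rightarrow> 'a \<Rightarrow> real) \<Rightarrow> real \<Rightarrow> bool" where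
  "has_extremal_index M R \<theta> \<longleftrightarrow>
     stationary_seq M R \<and> \<theta> \<in> {0..1} \<and>
     (\<forall>\<tau>>0. \<exists>u :: nat \<Rightarrow> real.
        (\<lambda>n. real n * (1 - cdf (distr M borel (R 1)) (u n))) \<longlonglongrightarrow> \<tau> \<and>
        (\<lambda>n. measure M {\<omega> \<in> space M. partial_max R n \<omega> \<le> u n}) \<longlonglongrightarrow> exp (- \<tau> * \<theta>))"

text \<open>
  Independence of whole sequences: each is one random element of the product space over
  \<open>{1..}\<close>. Within each sequence the dependence is arbitrary.
\<close>

definition indep_seqs :: "'a measure \<Rightarrow> (nat \<Rightarrow> nat \<Rightarrow> 'a \<Rightarrow> real) \<Rightarrow> nat set \<Rightarrow> bool" where
  "indep_seqs M Y I \<longleftrightarrow>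
     prob_space.indep_vars M (\<lambda>_. Pi\<^sub>M {1..} (\<lambda>_. borel)) (\<lambda>i \<omega>. \<lambda>n\<in>{1..}. Y i n \<omega>) I"

end

theory Submission
  imports Defs
begin

text \<open>
  A high level \<open>x\<close> is exceeded by the maximum, or by the sum, essentially only when the
  heaviest-tailed term \<open>X = z m * Y m\<close> exceeds it. Write \<open>S\<close> for the maximum or the sum, let
  \<open>k\<close> be the tail index of \<open>X\<close>, and let \<open>d x\<close> be the probability that exactly one of the
  events \<open>X 1 > x\<close> and \<open>S 1 > x\<close> occurs. Everything rests on \<open>d x = o(x powr (- k))\<close>.

  This estimate suffices (\<open>indices_transfer\<close>). The tails of \<open>S 1\<close> and \<open>X 1\<close> differ by at most
  \<open>d\<close>, so they are asymptotically equal. If levels \<open>u n\<close> witness the extremal index of \<open>X\<close> for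
  a given \<open>\<tau>\<close>, then \<open>u n\<close> tends to infinity and \<open>n * u n powr (- k)\<close> stays bounded. The events
  that the first \<open>n\<close> terms of \<open>S\<close>, respectively of \<open>X\<close>, stay below \<open>u n\<close> differ only if an
  exceedance disagrees at one of the \<open>n\<close> times, so their probabilities differ by at most
  \<open>n * d (u n)\<close>, which tends to 0. The same levels therefore work for \<open>S\<close>, however strong the
  dependence within the sequences.

  For the estimate (\<open>exceedance_diff_negligible\<close>) fix a small \<open>\<epsilon>\<close>. If the exceedances
  of \<open>X\<close> and \<open>S\<close> disagree at level \<open>x\<close>, one of three things happens:
  \<^item> \<open>X\<close> lies between \<open>(1 - \<epsilon>) * x\<close> and \<open>(1 + \<epsilon>) * x\<close>; after multiplication by
    \<open>x powr k\<close>, the probability of this tends to a quantity that vanishes with \<open>\<epsilon>\<close>;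
  \<^item> another term exceeds a fixed multiple of \<open>x\<close>, which is rarer because its tail index is larger;
  \<^item> \<open>X > (1 + \<epsilon>) * x\<close> while another term is below a negative multiple of \<open>x\<close>. The left tails
    are arbitrary, and this is where independence enters: the probability is a
    product of one factor of order \<open>x powr (- k)\<close> and one that tends to 0.

  The only properties of the maximum and the sum that matter are the two bounds in
  \<open>Max_dominated\<close> and \<open>sum_dominated\<close>.
\<close>

section \<open>Strictly stationary sequences\<close>

lemma stationary_seq_measurable:
  "stationary_seq M R \<Longrightarrow> n \<ge> 1 \<Longrightarrow> R n \<in> borel_measurable M"
  by (simp add: stationary_seq_def)

lemma stationary_seq_distr_shift:
  assumes "stationary_seq M R" "finite J" "J \<subseteq> {1..}"
  shows "distr M (Pi\<^sub>M J (\<lambda>_. borel)) (\<lambda>\<omega>. \<lambda>j\<in>J. R (j + h) \<omega>)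
       = distr M (Pi\<^sub>M J (\<lambda>_. borel)) (\<lambda>\<omega>. \<lambda>j\<in>J. R j \<omega>)"
  using assms unfolding stationary_seq_def by blast

lemma stationary_seq_prob_eq:
  assumes R: "stationary_seq M R" and n: "n \<ge> 1" and B: "B \<in> sets borel"
  shows "\<P>(\<omega> in M. R n \<omega> \<in> B) = \<P>(\<omega> in M. R 1 \<omega> \<in> B)"
proof -
  let ?P = "Pi\<^sub>M {1::nat} (\<lambda>_. borel :: real measure)"
  let ?V = "\<lambda>h \<omega>. \<lambda>j\<in>{1}. R (j + h) \<omega>"
  have meas: "?V h \<in> measurable M ?P" for h
    using R by (intro measurable_restrict) (auto simp: stationary_seq_def)
  have dist: "distr M ?P (?V (n - 1)) = distr M ?P (?V 0)"
    using stationary_seq_distr_shift[OF R, of "{1}" "n - 1"] by simp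
  have C: "{v \<in> space ?P. v 1 \<in> B} \<in> sets ?P"
    using B by measurable
  have val: "measure (distr M ?P (?V h)) {v \<in> space ?P. v 1 \<in> B} = \<P>(\<omega> in M. R (1 + h) \<omega> \<in> B)" for h
    unfolding measure_distr[OF meas C]
    by (rule arg_cong[where f = "measure M"])
       (use measurable_space[OF meas[of h]] in auto)
  show ?thesis using val[of "n - 1"] val[of 0] dist n by simp
qed

lemma stationary_seq_comp:
  assumes R: "stationary_seq M R" and g: "g \<in> borel_measurable borel"
  shows "stationary_seq M (\<lambda>n \<omega>. g (R n \<omega>))"
  unfolding stationary_seq_def
proof (intro conjI allI impI)
  show "(\<lambda>\<omega>. g (R n \<omega>)) \<in> borel_measurable M" if "n \<ge> 1" for n
    using measurable_compose[OF stationary_seq_measurable[OF R that] g] .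
next
  fix h :: nat and J :: "nat set" assume J: "finite J \<and> J \<subseteq> {1..}"
  let ?P = "Pi\<^sub>M J (\<lambda>_. borel :: real measure)"
  define G :: "(nat \<Rightarrow> real) \<Rightarrow> nat \<Rightarrow> real" where "G = (\<lambda>v. \<lambda>j\<in>J. g (v j))"
  have G: "G \<in> measurable ?P ?P"
    unfolding G_def using g by measurable
  have meas: "(\<lambda>\<omega>. \<lambda>j\<in>J. R (j + h) \<omega>) \<in> measurable M ?P" for h
    using R J by (intro measurable_restrict) (auto simp: stationary_seq_def)
  have *: "distr M ?P (\<lambda>\<omega>. \<lambda>j\<in>J. g (R (j + h) \<omega>))
      = distr (distr M ?P (\<lambda>\<omega>. \<lambda>j\<in>J. R (j + h) \<omega>)) ?P G" for h
    unfolding distr_distr[OF G meas]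
    by (intro arg_cong[where f = "distr M ?P"]) (auto simp: G_def o_def fun_eq_iff)
  show "distr M ?P (\<lambda>\<omega>. \<lambda>j\<in>J. g (R (j + h) \<omega>)) = distr M ?P (\<lambda>\<omega>. \<lambda>j\<in>J. g (R j \<omega>))"
    using *[of h] *[of 0] R J by (simp add: stationary_seq_def)
qed

text \<open>
  Independence determines the joint law of the blocks \<open>(Y i (j + h))\<close>, with \<open>j \<in> J\<close>, as the product
  over \<open>i\<close> of the laws of the single blocks, and none of these factors depends on \<open>h\<close>. Without
  independence, sequences that are stationary one by one need not be jointly stationary.
\<close>

lemma stationary_seq_combine:
  assumes M: "prob_space M" and I: "finite I" "I \<noteq> {}"
    and indep: "indep_seqs M Y I"
    and Y: "\<And>i. i \<in> I \<Longrightarrow> stationary_seq M (Y i)"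
    and f: "f \<in> borel_measurable (Pi\<^sub>M I (\<lambda>_. borel))"
  shows "stationary_seq M (\<lambda>n \<omega>. f (\<lambda>i\<in>I. Y i n \<omega>))"
  unfolding stationary_seq_def
proof (intro conjI allI impI)
  fix n :: nat assume n: "n \<ge> 1"
  have "(\<lambda>\<omega>. \<lambda>i\<in>I. Y i n \<omega>) \<in> measurable M (Pi\<^sub>M I (\<lambda>_. borel))"
    using Y n by (intro measurable_restrict) (auto simp: stationary_seq_def)
  from measurable_compose[OF this f]
  show "(\<lambda>\<omega>. f (\<lambda>i\<in>I. Y i n \<omega>)) \<in> borel_measurable M" .
next
  interpret prob_space M by (rule M)
  fix h :: nat and J :: "nat set" assume J: "finite J \<and> J \<subseteq> {1..}"
  let ?P = "Pi\<^sub>M J (\<lambda>_. borel :: real measure)"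
  let ?Q = "Pi\<^sub>M I (\<lambda>_. ?P)"
  define Z where "Z = (\<lambda>h i \<omega>. \<lambda>j\<in>J. Y i (j + h) \<omega>)"
  \<comment> \<open>\<open>Z h i\<close> is the block of sequence \<open>i\<close> shifted by \<open>h\<close>; \<open>\<psi>\<close> applies \<open>f\<close> across the sequences
     at each time.\<close>
  define \<psi> where "\<psi> = (\<lambda>v. \<lambda>j\<in>J. f (\<lambda>i\<in>I. v i j))"
  have Z_meas: "Z h i \<in> measurable M ?P" if "i \<in> I" for h i
    unfolding Z_def using Y[OF that] J
    by (intro measurable_restrict) (auto simp: stationary_seq_def)
  have Z_indep: "indep_vars (\<lambda>_. ?P) (Z h) I" for h
  proof -
    have "indep_vars (\<lambda>_. ?P) (\<lambda>i \<omega>. (\<lambda>y. \<lambda>j\<in>J. y (j + h)) (\<lambda>n\<in>{1..}. Y i n \<omega>)) I"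
    proof (rule indep_vars_compose2[where X = "\<lambda>i \<omega>. \<lambda>n\<in>{1..}. Y i n \<omega>" and Y = "\<lambda>_ y. \<lambda>j\<in>J. y (j + h)"
          and M' = "\<lambda>_. Pi\<^sub>M {1..} (\<lambda>_. borel)"])
      show "indep_vars (\<lambda>_. Pi\<^sub>M {1..} (\<lambda>_. borel)) (\<lambda>i \<omega>. \<lambda>n\<in>{1..}. Y i n \<omega>) I"
        using indep unfolding indep_seqs_def .
      show "(\<lambda>y. \<lambda>j\<in>J. y (j + h)) \<in> measurable (Pi\<^sub>M {1..} (\<lambda>_. borel)) ?P" if "i \<in> I" for i
        using J by (intro measurable_restrict measurable_component_singleton) auto
    qed
    also have "(\<lambda>i \<omega>. (\<lambda>y. \<lambda>j\<in>J. y (j + h)) (\<lambda>n\<in>{1..}. Y i n \<omega>)) = Z h"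
      using J unfolding Z_def by (intro ext restrict_ext) auto
    finally show ?thesis .
  qed
  have joint: "distr M ?Q (\<lambda>\<omega>. \<lambda>i\<in>I. Z h i \<omega>) = Pi\<^sub>M I (\<lambda>i. distr M ?P (Z h i))" for h
    using indep_vars_iff_distr_eq_PiM'[OF I(2) Z_meas, THEN iffD1, OF _ Z_indep] by blast
  have "distr M ?P (Z h i) = distr M ?P (Z 0 i)" if "i \<in> I" for i
    using Y[OF that] J unfolding Z_def stationary_seq_def by simp
  then have eq: "distr M ?Q (\<lambda>\<omega>. \<lambda>i\<in>I. Z h i \<omega>) = distr M ?Q (\<lambda>\<omega>. \<lambda>i\<in>I. Z 0 i \<omega>)"
    unfolding joint by (rule PiM_cong[OF refl])
  have coord: "(\<lambda>v. v i j) \<in> measurable ?Q borel" if "i \<in> I" "j \<in> J" for i j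
    by (rule measurable_compose[where N = ?P and f = "\<lambda>v. v i" and g = "\<lambda>y. y j"])
       (use that in \<open>auto intro: measurable_component_singleton\<close>)
  have \<psi>: "\<psi> \<in> measurable ?Q ?P"
    unfolding \<psi>_def
    by (intro measurable_restrict measurable_compose[OF _ f] coord)
  have meas: "(\<lambda>\<omega>. \<lambda>i\<in>I. Z h i \<omega>) \<in> measurable M ?Q" for h
    by (intro measurable_restrict Z_meas)
  have *: "distr M ?P (\<lambda>\<omega>. \<lambda>j\<in>J. f (\<lambda>i\<in>I. Y i (j + h) \<omega>))
      = distr (distr M ?Q (\<lambda>\<omega>. \<lambda>i\<in>I. Z h i \<omega>)) ?P \<psi>" for h
    unfolding distr_distr[OF \<psi> meas]
    by (intro arg_cong[where f = "distr M ?P"] ext) (simp add: \<psi>_def Z_def cong: restrict_cong)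
  show "distr M ?P (\<lambda>\<omega>. \<lambda>j\<in>J. f (\<lambda>i\<in>I. Y i (j + h) \<omega>))
      = distr M ?P (\<lambda>\<omega>. \<lambda>j\<in>J. f (\<lambda>i\<in>I. Y i j \<omega>))"
    using *[of h] *[of 0] eq by simp
qed

section \<open>Power tails\<close>

text \<open>
  Power tails are handled as limits of \<open>x powr k * F x\<close>, to which the arithmetic of limits applies
  even when the limit is 0.
\<close>

lemma asymp_equiv_powr_iff:
  fixes F :: "real \<Rightarrow> real"
  assumes "c > 0"
  shows "F \<sim>[at_top] (\<lambda>x. c * x powr (- k)) \<longleftrightarrow> ((\<lambda>x. x powr k * F x) \<longlongrightarrow> c) at_top"
proof -
  have "F \<sim>[at_top] (\<lambda>x. c * x powr (- k)) \<longleftrightarrow> ((\<lambda>x. F x / (c * x powr (- k))) \<longlongrightarrow> 1) at_top"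
    unfolding asymp_equiv_def
  proof (intro filterlim_cong refl)
    show "\<forall>\<^sub>F x in at_top. (if F x = 0 \<and> c * x powr - k = 0 then 1 else F x / (c * x powr - k)) = F x / (c * x powr - k)"
      using eventually_gt_at_top[of 0] by eventually_elim (use assms in auto)
  qed
  also have "\<dots> \<longleftrightarrow> ((\<lambda>x. (x powr k * F x) / c) \<longlongrightarrow> 1) at_top"
  proof (intro filterlim_cong refl)
    show "\<forall>\<^sub>F x in at_top. F x / (c * x powr - k) = x powr k * F x / c"
      using eventually_gt_at_top[of 0]
      by eventually_elim (use assms in \<open>simp add: powr_minus field_simps\<close>)
  qed
  also have "\<dots> \<longleftrightarrow> ((\<lambda>x. x powr k * F x) \<longlongrightarrow> c) at_top"
  proof
    assume "((\<lambda>x. (x powr k * F x) / c) \<longlongrightarrow> 1) at_top"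
    from tendsto_mult[OF tendsto_const[of c] this] show "((\<lambda>x. x powr k * F x) \<longlongrightarrow> c) at_top"
      using assms by simp
  next
    assume "((\<lambda>x. x powr k * F x) \<longlongrightarrow> c) at_top"
    from tendsto_divide[OF this tendsto_const[of c]] show "((\<lambda>x. (x powr k * F x) / c) \<longlongrightarrow> 1) at_top"
      using assms by simp
  qed
  finally show ?thesis .
qed

lemma has_tail_index_iff:
  "has_tail_index M R k \<longleftrightarrow> stationary_seq M R \<and> k > 0 \<and>
     (\<exists>c>0. ((\<lambda>x. x powr k * \<P>(\<omega> in M. R 1 \<omega> > x)) \<longlongrightarrow> c) at_top)"
proof (cases "stationary_seq M R")
  case True
  define F where "F n x = \<P>(\<omega> in M. R n \<omega> > x)" for n x
  have "F n = F 1" if "n \<ge> 1" for n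
    using stationary_seq_prob_eq[OF True that, of "{_<..}"] unfolding F_def by (intro ext) simp
  then have "(\<forall>n\<ge>1. F n \<sim>[at_top] (\<lambda>x. c * x powr (- k)))
      \<longleftrightarrow> F 1 \<sim>[at_top] (\<lambda>x. c * x powr (- k))" for c
    by (metis order_refl)
  then have "(\<forall>n\<ge>1. F n \<sim>[at_top] (\<lambda>x. c * x powr (- k)))
      \<longleftrightarrow> ((\<lambda>x. x powr k * F 1 x) \<longlongrightarrow> c) at_top" if "c > 0" for c
    using asymp_equiv_powr_iff[OF that, of "F 1" k] by simp
  then have "(\<exists>c>0. \<forall>n\<ge>1. F n \<sim>[at_top] (\<lambda>x. c * x powr (- k)))
      \<longleftrightarrow> (\<exists>c>0. ((\<lambda>x. x powr k * F 1 x) \<longlongrightarrow> c) at_top)"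
    by blast
  then show ?thesis
    unfolding has_tail_index_def F_def by blast
qed (simp add: has_tail_index_def)

lemma powr_tail_rescale:
  fixes F :: "real \<Rightarrow> real"
  assumes "((\<lambda>x. x powr k * F x) \<longlongrightarrow> c) at_top" and a: "a > 0"
  shows "((\<lambda>x. x powr k * F (a * x)) \<longlongrightarrow> a powr (- k) * c) at_top"
proof -
  have "filterlim (\<lambda>x. a * x) at_top at_top"
    using a by (intro filterlim_tendsto_pos_mult_at_top[OF tendsto_const]) (auto intro: filterlim_ident)
  from filterlim_compose[OF assms(1) this]
  have "((\<lambda>x. a powr (- k) * ((a * x) powr k * F (a * x))) \<longlongrightarrow> a powr (- k) * c) at_top"
    by (intro tendsto_mult tendsto_const)
  moreover have "\<forall>\<^sub>F x in at_top. a powr (- k) * ((a * x) powr k * F (a * x)) = x powr k * F (a * x)"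
    using eventually_gt_at_top[of 0]
    by eventually_elim (use a in \<open>simp add: powr_mult powr_minus field_simps\<close>)
  ultimately show ?thesis by (rule Lim_transform_eventually)
qed

lemma powr_tail_lighter:
  fixes F :: "real \<Rightarrow> real"
  assumes "((\<lambda>x. x powr k' * F x) \<longlongrightarrow> c) at_top" and "k < k'"
  shows "((\<lambda>x. x powr k * F x) \<longlongrightarrow> 0) at_top"
proof -
  have "((\<lambda>x. x powr (k - k') * (x powr k' * F x)) \<longlongrightarrow> 0 * c) at_top"
    using assms by (intro tendsto_mult tendsto_neg_powr filterlim_ident) auto
  then show ?thesis
    by (simp add: mult.assoc[symmetric] powr_add[symmetric])
qed

lemma has_tail_index_scale:
  assumes "has_tail_index M R k" and z: "z > 0"
  shows "has_tail_index M (\<lambda>n \<omega>. z * R n \<omega>) k"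
proof -
  obtain c where R: "stationary_seq M R" and k: "k > 0" and c: "c > 0"
    and lim: "((\<lambda>x. x powr k * \<P>(\<omega> in M. R 1 \<omega> > x)) \<longlongrightarrow> c) at_top"
    using assms(1) unfolding has_tail_index_iff by auto
  have "stationary_seq M (\<lambda>n \<omega>. z * R n \<omega>)"
    by (rule stationary_seq_comp[OF R]) measurable
  moreover have "(\<lambda>x. \<P>(\<omega> in M. z * R 1 \<omega> > x)) = (\<lambda>x. \<P>(\<omega> in M. R 1 \<omega> > (1 / z) * x))"
    using z by (simp add: field_simps)
  then have "((\<lambda>x. x powr k * \<P>(\<omega> in M. z * R 1 \<omega> > x)) \<longlongrightarrow> (1 / z) powr (- k) * c) at_top"
    using powr_tail_rescale[OF lim, of "1 / z"] z by (simp add: fun_eq_iff)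
  moreover have "(1 / z) powr (- k) * c > 0" using z c by simp
  ultimately show ?thesis unfolding has_tail_index_iff using k by blast
qed

section \<open>Extremal index\<close>

lemma one_minus_cdf_distr:
  assumes "prob_space M" and [measurable]: "X \<in> borel_measurable M"
  shows "1 - cdf (distr M borel X) u = \<P>(\<omega> in M. X \<omega> > u)"
proof -
  interpret prob_space M by fact
  have "1 - cdf (distr M borel X) u = 1 - \<P>(\<omega> in M. X \<omega> \<le> u)"
    unfolding cdf_def by (subst measure_distr) (auto intro!: arg_cong[where f = "prob"])
  also have "\<dots> = \<P>(\<omega> in M. \<not> X \<omega> \<le> u)"
    by (subst prob_neg) auto
  finally show ?thesis by (simp add: not_le)
qed

lemma partial_max_le_iff:
  assumes "n \<ge> 1"
  shows "partial_max R n \<omega> \<le> u \<longleftrightarrow> (\<forall>j\<in>{1..n}. R j \<omega> \<le> u)"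
  using assms unfolding partial_max_def by (subst Max_le_iff) auto

text \<open>
  For \<open>n = 0\<close> the maximum of the empty set is unspecified, so the two formulations of the
  event agree only for \<open>n \<ge> 1\<close>; this does not affect the limit.
\<close>

lemma has_extremal_index_iff:
  assumes "prob_space M"
  shows "has_extremal_index M R \<theta> \<longleftrightarrow> stationary_seq M R \<and> \<theta> \<in> {0..1} \<and>
     (\<forall>\<tau>>0. \<exists>u :: nat \<Rightarrow> real.
        (\<lambda>n. real n * \<P>(\<omega> in M. R 1 \<omega> > u n)) \<longlonglongrightarrow> \<tau> \<and>
        (\<lambda>n. \<P>(\<omega> in M. \<forall>j\<in>{1..n}. R j \<omega> \<le> u n)) \<longlonglongrightarrow> exp (- \<tau> * \<theta>))"
proof -
  have 1: "1 - cdf (distr M borel (R 1)) u = \<P>(\<omega> in M. R 1 \<omega> > u)" if "stationary_seq M R" for u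
    using that by (intro one_minus_cdf_distr[OF assms]) (auto simp: stationary_seq_def)
  have 2: "(\<lambda>n. \<P>(\<omega> in M. partial_max R n \<omega> \<le> u n)) \<longlonglongrightarrow> L \<longleftrightarrow>
     (\<lambda>n. \<P>(\<omega> in M. \<forall>j\<in>{1..n}. R j \<omega> \<le> u n)) \<longlonglongrightarrow> L" for u L
    by (intro filterlim_cong refl eventually_mono[OF eventually_ge_at_top[of 1]])
       (simp add: partial_max_le_iff)
  show ?thesis unfolding has_extremal_index_def 2 using 1 by (simp cong: conj_cong)
qed

lemma has_extremal_index_scale:
  assumes M: "prob_space M" and R: "has_extremal_index M R \<theta>" and z: "z > 0"
  shows "has_extremal_index M (\<lambda>n \<omega>. z * R n \<omega>) \<theta>"
  unfolding has_extremal_index_iff[OF M]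
proof (intro conjI allI impI)
  show "stationary_seq M (\<lambda>n \<omega>. z * R n \<omega>)"
    by (rule stationary_seq_comp) (use R in \<open>auto simp: has_extremal_index_def\<close>)
  show "\<theta> \<in> {0..1}" using R by (auto simp: has_extremal_index_def)
next
  fix \<tau> :: real assume "\<tau> > 0"
  then obtain u where u: "(\<lambda>n. real n * \<P>(\<omega> in M. R 1 \<omega> > u n)) \<longlonglongrightarrow> \<tau>"
      "(\<lambda>n. \<P>(\<omega> in M. \<forall>j\<in>{1..n}. R j \<omega> \<le> u n)) \<longlonglongrightarrow> exp (- \<tau> * \<theta>)"
    using R unfolding has_extremal_index_iff[OF M] by blast
  show "\<exists>u. (\<lambda>n. real n * \<P>(\<omega> in M. z * R 1 \<omega> > u n)) \<longlonglongrightarrow> \<tau> \<and>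
        (\<lambda>n. \<P>(\<omega> in M. \<forall>j\<in>{1..n}. z * R j \<omega> \<le> u n)) \<longlonglongrightarrow> exp (- \<tau> * \<theta>)"
    using u z by (intro exI[of _ "\<lambda>n. z * u n"]) simp
qed

section \<open>Sequences with asymptotically equal exceedances\<close>

text \<open>
  The probability of exceeding \<open>u n\<close> is of order \<open>1 / n\<close>, hence falls below the positive
  probability of exceeding any fixed \<open>x\<close>.
\<close>

lemma levels_tend_to_infinity:
  fixes X :: "'a \<Rightarrow> real"
  assumes M: "prob_space M" and X[measurable]: "X \<in> borel_measurable M"
    and pos: "\<And>x. \<P>(\<omega> in M. X \<omega> > x) > 0"
    and u: "(\<lambda>n. real n * \<P>(\<omega> in M. X \<omega> > u n)) \<longlonglongrightarrow> \<tau>"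
  shows "filterlim u at_top sequentially"
proof (rule filterlim_at_top[THEN iffD2], rule allI)
  interpret prob_space M by (rule M)
  fix x
  have "(\<lambda>n. inverse (real n) * (real n * \<P>(\<omega> in M. X \<omega> > u n))) \<longlonglongrightarrow> 0 * \<tau>"
    by (intro tendsto_mult u lim_inverse_n)
  then have "(\<lambda>n. inverse (real n) * (real n * \<P>(\<omega> in M. X \<omega> > u n))) \<longlonglongrightarrow> 0"
    by simp
  moreover have "\<forall>\<^sub>F n in sequentially. inverse (real n) * (real n * \<P>(\<omega> in M. X \<omega> > u n)) = \<P>(\<omega> in M. X \<omega> > u n)"
    using eventually_gt_at_top[of 0] by eventually_elim simp
  ultimately have "(\<lambda>n. \<P>(\<omega> in M. X \<omega> > u n)) \<longlonglongrightarrow> 0"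
    by (rule Lim_transform_eventually)
  from order_tendstoD(2)[OF this pos[of x]]
  show "\<forall>\<^sub>F n in sequentially. x \<le> u n"
  proof eventually_elim
    case (elim n)
    show ?case
    proof (rule ccontr)
      assume "\<not> x \<le> u n"
      then have "\<P>(\<omega> in M. X \<omega> > x) \<le> \<P>(\<omega> in M. X \<omega> > u n)"
        by (intro finite_measure_mono) auto
      with elim show False by simp
    qed
  qed
qed

text \<open>
  Both indices depend only on exceedances of high levels. The hypothesis \<open>same\<close> is stationarity of
  the pair \<open>(X, S)\<close> in the form needed for the union bound over the first \<open>n\<close> times.
\<close>

lemma indices_transfer:
  assumes M: "prob_space M" and X: "has_tail_index M X k" and S: "stationary_seq M S"
    and same: "\<And>n x. n \<ge> 1 \<Longrightarrow>
      \<P>(\<omega> in M. (S n \<omega> > x) \<noteq> (X n \<omega> > x)) = \<P>(\<omega> in M. (S 1 \<omega> > x) \<noteq> (X 1 \<omega> > x))"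
    and diff: "((\<lambda>x. x powr k * \<P>(\<omega> in M. (S 1 \<omega> > x) \<noteq> (X 1 \<omega> > x))) \<longlongrightarrow> 0) at_top"
  shows "has_tail_index M S k"
    and "has_extremal_index M X \<theta> \<Longrightarrow> has_extremal_index M S \<theta>"
proof -
  interpret prob_space M by (rule M)
  obtain c where k: "k > 0" and c: "c > 0" and stX: "stationary_seq M X"
    and lim: "((\<lambda>x. x powr k * \<P>(\<omega> in M. X 1 \<omega> > x)) \<longlongrightarrow> c) at_top"
    using X unfolding has_tail_index_iff by auto
  have mX[measurable]: "X n \<in> borel_measurable M" if "n \<ge> 1" for n
    using stX that by (simp add: stationary_seq_def)
  have mS[measurable]: "S n \<in> borel_measurable M" if "n \<ge> 1" for n
    using S that by (simp add: stationary_seq_def)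
  have [measurable]: "X 1 \<in> borel_measurable M" "S 1 \<in> borel_measurable M"
    "X (Suc 0) \<in> borel_measurable M" "S (Suc 0) \<in> borel_measurable M"
    by (auto intro: mX mS)
  define d where "d x = \<P>(\<omega> in M. (S 1 \<omega> > x) \<noteq> (X 1 \<omega> > x))" for x
  define F where "F x = \<P>(\<omega> in M. X 1 \<omega> > x)" for x
  define G where "G x = \<P>(\<omega> in M. S 1 \<omega> > x)" for x
  have GF: "\<bar>G x - F x\<bar> \<le> d x" for x
  proof -
    have "G x \<le> prob ({\<omega> \<in> space M. X 1 \<omega> > x} \<union> {\<omega> \<in> space M. (S 1 \<omega> > x) \<noteq> (X 1 \<omega> > x)})"
      unfolding G_def by (intro finite_measure_mono) auto
    also have "\<dots> \<le> F x + d x" unfolding F_def d_def by (intro measure_Un_le) auto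
    finally have 1: "G x \<le> F x + d x" .
    have "F x \<le> prob ({\<omega> \<in> space M. S 1 \<omega> > x} \<union> {\<omega> \<in> space M. (S 1 \<omega> > x) \<noteq> (X 1 \<omega> > x)})"
      unfolding F_def by (intro finite_measure_mono) auto
    also have "\<dots> \<le> G x + d x" unfolding G_def d_def by (intro measure_Un_le) auto
    finally show ?thesis using 1 by simp
  qed
  have d0: "((\<lambda>x. x powr k * d x) \<longlongrightarrow> 0) at_top" using diff unfolding d_def .
  have limF: "((\<lambda>x. x powr k * F x) \<longlongrightarrow> c) at_top" using lim unfolding F_def .
  have "((\<lambda>x. x powr k * (G x - F x)) \<longlongrightarrow> 0) at_top"
    by (rule Lim_null_comparison[OF _ d0])
       (intro always_eventually allI, use GF in \<open>simp add: abs_mult mult_left_mono\<close>)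
  from tendsto_add[OF this limF] have limG: "((\<lambda>x. x powr k * G x) \<longlongrightarrow> c) at_top"
    by (simp add: algebra_simps)
  show "has_tail_index M S k"
    unfolding has_tail_index_iff using S k c limG unfolding G_def by blast

  assume ext: "has_extremal_index M X \<theta>"
  have F_mono: "F y \<le> F x" if "x \<le> y" for x y
    unfolding F_def using that by (intro finite_measure_mono) auto
  have "F x > 0" for x
  proof -
    have "\<forall>\<^sub>F y in at_top. y powr k * F y > 0 \<and> y \<ge> x"
      by (intro eventually_conj order_tendstoD(1)[OF limF c] eventually_ge_at_top)
    then obtain y where "y powr k * F y > 0" "y \<ge> x"
      using eventually_happens' trivial_limit_at_top_linorder by blast
    then have "F y > 0" by (simp add: zero_less_mult_iff)
    with F_mono[OF \<open>y \<ge> x\<close>] show ?thesis by simp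
  qed
  then have pos: "\<P>(\<omega> in M. X 1 \<omega> > x) > 0" for x unfolding F_def .
  show "has_extremal_index M S \<theta>"
    unfolding has_extremal_index_iff[OF M]
  proof (intro conjI allI impI)
    show "stationary_seq M S" by (rule S)
    show "\<theta> \<in> {0..1}" using ext by (simp add: has_extremal_index_def)
  next
    fix \<tau> :: real assume "\<tau> > 0"
    then obtain u where u1: "(\<lambda>n. real n * F (u n)) \<longlonglongrightarrow> \<tau>"
      and u2: "(\<lambda>n. \<P>(\<omega> in M. \<forall>j\<in>{1..n}. X j \<omega> \<le> u n)) \<longlonglongrightarrow> exp (- \<tau> * \<theta>)"
      using ext unfolding has_extremal_index_iff[OF M] F_def by blast
    have u_inf: "filterlim u at_top sequentially"
      using levels_tend_to_infinity[OF M _ pos] u1 unfolding F_def by simp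
    \<comment> \<open>\<open>d = o(F)\<close> while \<open>n * F (u n)\<close> converges, so the factor \<open>n\<close> of the union bound is harmless.\<close>
    have "((\<lambda>x. (x powr k * d x) / (x powr k * F x)) \<longlongrightarrow> 0 / c) at_top"
      using c by (intro tendsto_divide d0 limF) auto
    from filterlim_compose[OF this u_inf]
    have "(\<lambda>n. (real n * F (u n)) * ((u n powr k * d (u n)) / (u n powr k * F (u n)))) \<longlonglongrightarrow> \<tau> * (0 / c)"
      by (intro tendsto_mult u1)
    then have "(\<lambda>n. (real n * F (u n)) * ((u n powr k * d (u n)) / (u n powr k * F (u n)))) \<longlonglongrightarrow> 0"
      by simp
    moreover have "\<forall>\<^sub>F n in sequentially.
        (real n * F (u n)) * ((u n powr k * d (u n)) / (u n powr k * F (u n))) = real n * d (u n)"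
      using filterlim_at_top_dense[THEN iffD1, OF u_inf, rule_format, of 0]
      by eventually_elim (use \<open>\<And>x. F x > 0\<close> in \<open>simp add: field_simps less_imp_neq[symmetric]\<close>)
    ultimately have nd: "(\<lambda>n. real n * d (u n)) \<longlonglongrightarrow> 0"
      by (rule Lim_transform_eventually)

    have "(\<lambda>n. real n * (G (u n) - F (u n))) \<longlonglongrightarrow> 0"
      by (rule Lim_null_comparison[OF _ nd])
         (intro always_eventually allI, use GF in \<open>simp add: abs_mult mult_left_mono\<close>)
    from tendsto_add[OF this u1] have c1: "(\<lambda>n. real n * G (u n)) \<longlonglongrightarrow> \<tau>"
      by (simp add: algebra_simps)

    define pX where "pX n = \<P>(\<omega> in M. \<forall>j\<in>{1..n}. X j \<omega> \<le> u n)" for n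
    define pS where "pS n = \<P>(\<omega> in M. \<forall>j\<in>{1..n}. S j \<omega> \<le> u n)" for n
    have "\<bar>pS n - pX n\<bar> \<le> real n * d (u n)" for n
    proof -
      \<comment> \<open>Outside \<open>D\<close> the two sequences exceed \<open>u n\<close> at the same times up to \<open>n\<close>.\<close>
      define D where "D = (\<Union>j\<in>{1..n}. {\<omega> \<in> space M. (S j \<omega> > u n) \<noteq> (X j \<omega> > u n)})"
      have Dj: "{\<omega> \<in> space M. (S j \<omega> > u n) \<noteq> (X j \<omega> > u n)} \<in> events" if "j \<in> {1..n}" for j
      proof -
        have [measurable]: "X j \<in> borel_measurable M" "S j \<in> borel_measurable M"
          using that mX mS by auto
        show ?thesis by measurable
      qed
      have Dm: "D \<in> events" unfolding D_def using Dj by (intro sets.finite_UN) auto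
      have "prob D \<le> (\<Sum>j\<in>{1..n}. \<P>(\<omega> in M. (S j \<omega> > u n) \<noteq> (X j \<omega> > u n)))"
        unfolding D_def using Dj by (intro finite_measure_subadditive_finite) auto
      also have "\<dots> = (\<Sum>j\<in>{1..n}. d (u n))"
        unfolding d_def by (intro sum.cong refl same) auto
      also have "\<dots> = real n * d (u n)" by simp
      finally have pD: "prob D \<le> real n * d (u n)" .
      have Xe: "{\<omega> \<in> space M. \<forall>j\<in>{1..n}. X j \<omega> \<le> u n} \<in> events"
      proof (intro sets.sets_Collect_finite_All)
        fix j assume "j \<in> {1..n}"
        then have [measurable]: "X j \<in> borel_measurable M" using mX by auto
        show "{\<omega> \<in> space M. X j \<omega> \<le> u n} \<in> events" by measurable
      qed simp
      have Se: "{\<omega> \<in> space M. \<forall>j\<in>{1..n}. S j \<omega> \<le> u n} \<in> events"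
      proof (intro sets.sets_Collect_finite_All)
        fix j assume "j \<in> {1..n}"
        then have [measurable]: "S j \<in> borel_measurable M" using mS by auto
        show "{\<omega> \<in> space M. S j \<omega> \<le> u n} \<in> events" by measurable
      qed simp
      have "S j \<omega> \<le> u n \<longleftrightarrow> X j \<omega> \<le> u n" if "\<omega> \<in> space M" "\<omega> \<notin> D" "j \<in> {1..n}" for \<omega> j
        using that unfolding D_def by (simp add: not_le[symmetric])
      then have agree: "(\<forall>j\<in>{1..n}. S j \<omega> \<le> u n) \<longleftrightarrow> (\<forall>j\<in>{1..n}. X j \<omega> \<le> u n)"
        if "\<omega> \<in> space M" "\<omega> \<notin> D" for \<omega>
        using that by blast
      have sub: "{\<omega> \<in> space M. \<forall>j\<in>{1..n}. S j \<omega> \<le> u n} \<subseteq> {\<omega> \<in> space M. \<forall>j\<in>{1..n}. X j \<omega> \<le> u n} \<union> D"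
        "{\<omega> \<in> space M. \<forall>j\<in>{1..n}. X j \<omega> \<le> u n} \<subseteq> {\<omega> \<in> space M. \<forall>j\<in>{1..n}. S j \<omega> \<le> u n} \<union> D"
        using agree by blast+
      have "pS n \<le> pX n + prob D"
        unfolding pS_def pX_def
        by (rule order_trans[OF finite_measure_mono[OF sub(1)] measure_Un_le]) (use Xe Se Dm in auto)
      moreover have "pX n \<le> pS n + prob D"
        unfolding pS_def pX_def
        by (rule order_trans[OF finite_measure_mono[OF sub(2)] measure_Un_le]) (use Xe Se Dm in auto)
      ultimately show ?thesis using pD by linarith
    qed
    then have "(\<lambda>n. pS n - pX n) \<longlonglongrightarrow> 0"
      by (intro Lim_null_comparison[OF _ nd] always_eventually) simp
    from tendsto_add[OF this u2[folded pX_def]] have "pS \<longlonglongrightarrow> exp (- \<tau> * \<theta>)"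
      by simp
    with c1 show "\<exists>u. (\<lambda>n. real n * \<P>(\<omega> in M. S 1 \<omega> > u n)) \<longlonglongrightarrow> \<tau> \<and>
        (\<lambda>n. \<P>(\<omega> in M. \<forall>j\<in>{1..n}. S j \<omega> \<le> u n)) \<longlonglongrightarrow> exp (- \<tau> * \<theta>)"
      unfolding G_def pS_def by blast
  qed
qed

section \<open>One dominant summand\<close>

lemma sum_pos_part_exceeds:
  fixes w :: "'i \<Rightarrow> real"
  assumes "finite I" "(\<Sum>i\<in>I. max 0 (w i)) > y" "y > 0" "real (card I) \<le> N"
  shows "\<exists>i\<in>I. w i > y / N"
proof (rule ccontr)
  assume "\<not> (\<exists>i\<in>I. w i > y / N)"
  then have le: "w i \<le> y / N" if "i \<in> I" for i
    using that by force
  have "I \<noteq> {}" using assms(2,3) by auto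
  then have "card I > 0" using assms(1) by (simp add: card_gt_0_iff)
  then have N: "N > 0" using assms(4) by linarith
  have "(\<Sum>i\<in>I. max 0 (w i)) \<le> (\<Sum>i\<in>I. y / N)"
    using le N assms(3) by (intro sum_mono) auto
  also have "\<dots> = real (card I) * (y / N)" by simp
  also have "\<dots> \<le> N * (y / N)"
    using assms(3,4) N by (intro mult_right_mono) auto
  also have "\<dots> = y" using N by simp
  finally show False using assms(2) by simp
qed

text \<open>
  The hypotheses \<open>upper\<close> and \<open>lower\<close> say that \<open>S\<close> can move away from \<open>W m\<close> to the other side of the
  level only with the help of a large positive, respectively large negative, value of some other
  term. Positive values are controlled by the lighter right tails; for negative values, which may be
  frequent, there is only independence from \<open>W m\<close>.
\<close>

lemma exceedance_diff_negligible:
  fixes W :: "'i \<Rightarrow> 'a \<Rightarrow> real"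
  assumes M: "prob_space M" and I: "finite I" "m \<in> I"
    and W: "\<And>i. i \<in> I \<Longrightarrow> W i \<in> borel_measurable M"
    and S: "S \<in> borel_measurable M"
    and main: "((\<lambda>x. x powr k * \<P>(\<omega> in M. W m \<omega> > x)) \<longlongrightarrow> c) at_top"
    and light: "\<And>i. i \<in> I - {m} \<Longrightarrow> ((\<lambda>x. x powr k * \<P>(\<omega> in M. W i \<omega> > x)) \<longlongrightarrow> 0) at_top"
    and indep: "\<And>i. i \<in> I - {m} \<Longrightarrow> prob_space.indep_var M borel (W m) borel (W i)"
    and upper: "\<And>\<omega>. S \<omega> \<le> max 0 (W m \<omega>) + (\<Sum>i\<in>I - {m}. max 0 (W i \<omega>))"
    and lower: "\<And>\<omega>. W m \<omega> - (\<Sum>i\<in>I - {m}. max 0 (- W i \<omega>)) \<le> S \<omega>"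
  shows "((\<lambda>x. x powr k * \<P>(\<omega> in M. (S \<omega> > x) \<noteq> (W m \<omega> > x))) \<longlongrightarrow> 0) at_top"
proof -
  interpret prob_space M by (rule M)
  define F where "F i x = \<P>(\<omega> in M. W i \<omega> > x)" for i x
  define L where "L i x = \<P>(\<omega> in M. W i \<omega> < - x)" for i x
  define d where "d x = \<P>(\<omega> in M. (S \<omega> > x) \<noteq> (W m \<omega> > x))" for x
  define N where "N = real (card I)"
  have N: "N \<ge> 1" "real (card (I - {m})) \<le> N"
    using I by (auto simp: N_def card_gt_0_iff Suc_le_eq intro: card_mono)
  \<comment> \<open>The three summands bound the three ways of disagreeing: \<open>W m\<close> close to the level, another term
     large and positive, another term large and negative while \<open>W m\<close> is high.\<close>
  define B where "B \<epsilon> x = (F m ((1 - \<epsilon>) * x) - F m ((1 + \<epsilon>) * x))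
      + (\<Sum>i\<in>I - {m}. F i (\<epsilon> / N * x)) + (\<Sum>i\<in>I - {m}. F m ((1 + \<epsilon>) * x) * L i (\<epsilon> / N * x))" for \<epsilon> x
  have ev[measurable]: "{\<omega> \<in> space M. W i \<omega> > x} \<in> events" "{\<omega> \<in> space M. W i \<omega> < x} \<in> events" if "i \<in> I" for i x
    using W[OF that] by measurable
  note W[OF I(2), measurable]

  have bound: "d x \<le> B \<epsilon> x" if \<epsilon>: "0 < \<epsilon>" "\<epsilon> < 1" and x: "x > 0" for \<epsilon> x
  proof -
    define A1 where "A1 = {\<omega> \<in> space M. W m \<omega> > (1 - \<epsilon>) * x} - {\<omega> \<in> space M. W m \<omega> > (1 + \<epsilon>) * x}"
    define A2 where "A2 = (\<Union>i\<in>I - {m}. {\<omega> \<in> space M. W i \<omega> > \<epsilon> / N * x})"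
    define A3 where "A3 = (\<Union>i\<in>I - {m}. {\<omega> \<in> space M. W m \<omega> > (1 + \<epsilon>) * x \<and> W i \<omega> < - (\<epsilon> / N * x)})"
    have A3i: "{\<omega> \<in> space M. W m \<omega> > (1 + \<epsilon>) * x \<and> W i \<omega> < - (\<epsilon> / N * x)} \<in> events" if "i \<in> I - {m}" for i
    proof -
      have [measurable]: "W i \<in> borel_measurable M" using W that by auto
      show ?thesis by measurable
    qed
    have meas: "A1 \<in> events" "A2 \<in> events" "A3 \<in> events"
      unfolding A1_def A2_def A3_def using I A3i by (auto intro!: sets.finite_UN sets.Diff ev)
    have "{\<omega> \<in> space M. (S \<omega> > x) \<noteq> (W m \<omega> > x)} \<subseteq> A1 \<union> A2 \<union> A3"
    proof
      fix \<omega> assume "\<omega> \<in> {\<omega> \<in> space M. (S \<omega> > x) \<noteq> (W m \<omega> > x)}"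
      then have \<omega>: "\<omega> \<in> space M" and neq: "(S \<omega> > x) \<noteq> (W m \<omega> > x)" by auto
      have \<epsilon>x: "\<epsilon> * x > 0" "\<epsilon> * x < x" using \<epsilon> x by auto
      show "\<omega> \<in> A1 \<union> A2 \<union> A3"
      proof (cases "W m \<omega> > (1 - \<epsilon>) * x")
        case False
        then have Wm: "W m \<omega> \<le> x - \<epsilon> * x" by (simp add: algebra_simps)
        with \<epsilon>x neq have "S \<omega> > x" by linarith
        with upper[of \<omega>] Wm \<epsilon>x have "(\<Sum>i\<in>I - {m}. max 0 (W i \<omega>)) > \<epsilon> * x" by linarith
        from sum_pos_part_exceeds[OF _ this _ N(2)] \<epsilon>x I obtain i
          where "i \<in> I - {m}" "W i \<omega> > \<epsilon> * x / N" by auto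
        then show ?thesis using \<omega> unfolding A2_def by auto
      next
        case low: True
        show ?thesis
        proof (cases "W m \<omega> > (1 + \<epsilon>) * x")
          case False
          then show ?thesis using low \<omega> unfolding A1_def by auto
        next
          case True
          then have Wm: "W m \<omega> > x + \<epsilon> * x" by (simp add: algebra_simps)
          with \<epsilon>x neq have "S \<omega> \<le> x" by linarith
          with lower[of \<omega>] Wm have "(\<Sum>i\<in>I - {m}. max 0 (- W i \<omega>)) > \<epsilon> * x" by linarith
          from sum_pos_part_exceeds[OF _ this _ N(2)] \<epsilon>x I obtain i
            where i: "i \<in> I - {m}" and "- W i \<omega> > \<epsilon> * x / N" by auto
          then have "W i \<omega> < - (\<epsilon> / N * x)" by simp
          with i show ?thesis using \<omega> True unfolding A3_def by blast
        qed
      qed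
    qed
    then have "d x \<le> prob (A1 \<union> A2 \<union> A3)"
      unfolding d_def using meas by (intro finite_measure_mono) auto
    also have "\<dots> \<le> prob A1 + prob A2 + prob A3"
      using measure_Un_le[of "A1 \<union> A2" M A3] measure_Un_le[of A1 M A2] meas by auto
    finally have "d x \<le> prob A1 + prob A2 + prob A3" .
    moreover have "prob A1 = F m ((1 - \<epsilon>) * x) - F m ((1 + \<epsilon>) * x)"
    proof -
      have "(1 - \<epsilon>) * x \<le> (1 + \<epsilon>) * x" using \<epsilon> x by (intro mult_right_mono) auto
      then show ?thesis
        unfolding A1_def F_def by (intro finite_measure_Diff ev I) auto
    qed
    moreover have "prob A2 \<le> (\<Sum>i\<in>I - {m}. F i (\<epsilon> / N * x))"
      unfolding A2_def F_def using I by (intro finite_measure_subadditive_finite) auto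
    moreover have "prob A3 \<le> (\<Sum>i\<in>I - {m}. F m ((1 + \<epsilon>) * x) * L i (\<epsilon> / N * x))"
    proof -
      have "\<P>(\<omega> in M. W m \<omega> > (1 + \<epsilon>) * x \<and> W i \<omega> < - (\<epsilon> / N * x)) = F m ((1 + \<epsilon>) * x) * L i (\<epsilon> / N * x)"
        if "i \<in> I - {m}" for i
        using prob_indep_random_variable[OF indep[OF that], of "{(1 + \<epsilon>) * x<..}" "{..< - (\<epsilon> / N * x)}"]
        unfolding F_def L_def by simp
      moreover have "prob A3 \<le> (\<Sum>i\<in>I - {m}. \<P>(\<omega> in M. W m \<omega> > (1 + \<epsilon>) * x \<and> W i \<omega> < - (\<epsilon> / N * x)))"
        unfolding A3_def using I A3i by (intro finite_measure_subadditive_finite) auto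
      ultimately show ?thesis by simp
    qed
    ultimately show ?thesis unfolding B_def by linarith
  qed

  have L0: "(L i \<longlongrightarrow> 0) at_top" if "i \<in> I - {m}" for i
  proof -
    have [measurable]: "W i \<in> borel_measurable M" using W that by auto
    interpret D: real_distribution "distr M borel (W i)"
      by (rule real_distribution_distr) simp
    have "filterlim (\<lambda>x::real. - x) at_bot at_top" by (rule filterlim_uminus_at_bot_at_top)
    from filterlim_compose[OF D.cdf_lim_at_bot this]
    have lim: "((\<lambda>x. cdf (distr M borel (W i)) (- x)) \<longlongrightarrow> 0) at_top" .
    have "L i x \<le> cdf (distr M borel (W i)) (- x)" for x
      unfolding L_def cdf_def by (subst measure_distr) (auto intro!: finite_measure_mono)
    then show ?thesis
      by (intro tendsto_sandwich[OF _ _ tendsto_const lim] always_eventually allI)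
         (auto simp: L_def)
  qed

  have limB: "((\<lambda>x. x powr k * B \<epsilon> x) \<longlongrightarrow> ((1 - \<epsilon>) powr (- k) - (1 + \<epsilon>) powr (- k)) * c) at_top"
    if \<epsilon>: "0 < \<epsilon>" "\<epsilon> < 1" for \<epsilon>
  proof -
    have \<epsilon>N: "\<epsilon> / N > 0" using \<epsilon> N by simp
    have Fm: "((\<lambda>x. x powr k * F m (a * x)) \<longlongrightarrow> a powr (- k) * c) at_top" if "a > 0" for a
      using main that unfolding F_def by (rule powr_tail_rescale)
    have Fi: "((\<lambda>x. x powr k * F i (\<epsilon> / N * x)) \<longlongrightarrow> 0) at_top" if "i \<in> I - {m}" for i
      using powr_tail_rescale[OF light[OF that] \<epsilon>N] unfolding F_def by simp
    have "filterlim (\<lambda>x. \<epsilon> / N * x) at_top at_top"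
      by (rule filterlim_tendsto_pos_mult_at_top[OF tendsto_const \<epsilon>N filterlim_ident])
    then have Li: "((\<lambda>x. L i (\<epsilon> / N * x)) \<longlongrightarrow> 0) at_top" if "i \<in> I - {m}" for i
      by (rule filterlim_compose[OF L0[OF that]])
    have "((\<lambda>x. (x powr k * F m ((1 - \<epsilon>) * x) - x powr k * F m ((1 + \<epsilon>) * x))
        + (\<Sum>i\<in>I - {m}. x powr k * F i (\<epsilon> / N * x))
        + (\<Sum>i\<in>I - {m}. (x powr k * F m ((1 + \<epsilon>) * x)) * L i (\<epsilon> / N * x)))
      \<longlongrightarrow> ((1 - \<epsilon>) powr (- k) * c - (1 + \<epsilon>) powr (- k) * c)
        + (\<Sum>i\<in>I - {m}. 0) + (\<Sum>i\<in>I - {m}. (1 + \<epsilon>) powr (- k) * c * 0)) at_top"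
      by (intro tendsto_add tendsto_diff tendsto_sum tendsto_mult[OF _ Li] Fm Fi) (use \<epsilon> in auto)
    then show ?thesis
      unfolding B_def by (simp add: algebra_simps sum_distrib_left)
  qed

  \<comment> \<open>The limit superior of \<open>x powr k * d x\<close> is at most the limit in \<open>limB\<close> for every \<open>\<epsilon>\<close>, and that bound vanishes
     as \<open>\<epsilon>\<close> tends to 0.\<close>
  have gap: "((\<lambda>\<epsilon>. ((1 - \<epsilon>) powr (- k) - (1 + \<epsilon>) powr (- k)) * c) \<longlongrightarrow> 0) (at_right 0)"
  proof -
    have "((\<lambda>\<epsilon>::real. ((1 - \<epsilon>) powr (- k) - (1 + \<epsilon>) powr (- k)) * c) \<longlongrightarrow> ((1 - 0) powr (- k) - (1 + 0) powr (- k)) * c) (at_right 0)"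
      by (intro tendsto_intros) auto
    then show ?thesis by simp
  qed

  have "((\<lambda>x. x powr k * d x) \<longlongrightarrow> 0) at_top"
  proof (rule order_tendstoI)
    fix a :: real assume "a < 0"
    moreover have "0 \<le> x powr k * d x" for x unfolding d_def by simp
    ultimately have "a < x powr k * d x" for x using less_le_trans by blast
    then show "\<forall>\<^sub>F x in at_top. a < x powr k * d x" by simp
  next
    fix a :: real assume a: "a > 0"
    have "\<forall>\<^sub>F \<epsilon> in at_right 0. ((1 - \<epsilon>) powr (- k) - (1 + \<epsilon>) powr (- k)) * c < a"
      by (rule order_tendstoD(2)[OF gap a])
    moreover have "\<forall>\<^sub>F \<epsilon> in at_right (0::real). \<epsilon> \<in> {0<..<1}"
      by (rule eventually_at_right_real) simp
    ultimately obtain \<epsilon> where "((1 - \<epsilon>) powr (- k) - (1 + \<epsilon>) powr (- k)) * c < a \<and> \<epsilon> \<in> {0<..<1}"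
      using eventually_happens'[OF trivial_limit_at_right_real eventually_conj] by blast
    then have \<epsilon>: "0 < \<epsilon>" "\<epsilon> < 1" and small: "((1 - \<epsilon>) powr (- k) - (1 + \<epsilon>) powr (- k)) * c < a"
      by simp_all
    from order_tendstoD(2)[OF limB[OF \<epsilon>] small] eventually_gt_at_top[of 0]
    show "\<forall>\<^sub>F x in at_top. x powr k * d x < a"
    proof eventually_elim
      case (elim x)
      have "x powr k * d x \<le> x powr k * B \<epsilon> x"
        by (intro mult_left_mono bound \<epsilon> elim) simp
      with elim show ?case by linarith
    qed
  qed
  then show ?thesis unfolding d_def .
qed

text \<open>
  The bounds on \<open>f\<close> cover the maximum and the sum at once. The arguments of \<open>f\<close> are
  restricted to \<open>I\<close> because points of the product space over \<open>I\<close> have the value \<open>undefined\<close>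
  outside \<open>I\<close>.
\<close>

lemma dominated_combination:
  fixes W :: "nat \<Rightarrow> nat \<Rightarrow> 'a \<Rightarrow> real" and f :: "(nat \<Rightarrow> real) \<Rightarrow> real"
  assumes M: "prob_space M" and I: "finite I" "m \<in> I"
    and indep: "indep_seqs M W I"
    and tail: "\<And>i. i \<in> I \<Longrightarrow> has_tail_index M (W i) (k i)"
    and ext: "has_extremal_index M (W m) \<theta>"
    and least: "\<And>i. i \<in> I \<Longrightarrow> i \<noteq> m \<Longrightarrow> k m < k i"
    and f[measurable]: "f \<in> borel_measurable (Pi\<^sub>M I (\<lambda>_. borel))"
    and upper: "\<And>w. f w \<le> max 0 (w m) + (\<Sum>i\<in>I - {m}. max 0 (w i))"
    and lower: "\<And>w. w m - (\<Sum>i\<in>I - {m}. max 0 (- w i)) \<le> f w"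
  shows "has_tail_index M (\<lambda>n \<omega>. f (\<lambda>i\<in>I. W i n \<omega>)) (k m)"
    and "has_extremal_index M (\<lambda>n \<omega>. f (\<lambda>i\<in>I. W i n \<omega>)) \<theta>"
proof -
  interpret prob_space M by (rule M)
  define S where "S n \<omega> = f (\<lambda>i\<in>I. W i n \<omega>)" for n \<omega>
  have ne: "I \<noteq> {}" using I by auto
  have st: "stationary_seq M (W i)" if "i \<in> I" for i
    using tail[OF that] by (simp add: has_tail_index_def)
  have stS: "stationary_seq M S"
    unfolding S_def by (rule stationary_seq_combine[OF M I(1) ne indep st f])
  have same: "\<P>(\<omega> in M. (S n \<omega> > x) \<noteq> (W m n \<omega> > x)) = \<P>(\<omega> in M. (S 1 \<omega> > x) \<noteq> (W m 1 \<omega> > x))"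
    if "n \<ge> 1" for n x
  proof -
    \<comment> \<open>Joint stationarity of \<open>S\<close> and \<open>W m\<close>: the disagreement is itself a function of the
       coordinates at time \<open>n\<close>, so its indicator is a stationary sequence.\<close>
    define g where "g w = (if (f w > x) \<noteq> (w m > x) then 1 else 0 :: real)" for w
    have [measurable]: "(\<lambda>w. w m) \<in> borel_measurable (Pi\<^sub>M I (\<lambda>_. borel :: real measure))"
      using I(2) by (rule measurable_component_singleton)
    have "g \<in> borel_measurable (Pi\<^sub>M I (\<lambda>_. borel))"
      unfolding g_def by measurable
    then have "stationary_seq M (\<lambda>n \<omega>. g (\<lambda>i\<in>I. W i n \<omega>))"
      using stationary_seq_combine[OF M I(1) ne indep st] by blast
    from stationary_seq_prob_eq[OF this that, of "{1}"] I(2)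
    have "\<P>(\<omega> in M. g (\<lambda>i\<in>I. W i n \<omega>) = 1) = \<P>(\<omega> in M. g (\<lambda>i\<in>I. W i 1 \<omega>) = 1)" by simp
    moreover have "g w = 1 \<longleftrightarrow> (f w > x) \<noteq> (w m > x)" for w by (simp add: g_def)
    ultimately show ?thesis using I(2) by (simp add: S_def)
  qed
  obtain c where lim: "((\<lambda>x. x powr k m * \<P>(\<omega> in M. W m 1 \<omega> > x)) \<longlongrightarrow> c) at_top"
    using tail[OF I(2)] unfolding has_tail_index_iff by blast
  have light: "((\<lambda>x. x powr k m * \<P>(\<omega> in M. W i 1 \<omega> > x)) \<longlongrightarrow> 0) at_top" if i: "i \<in> I - {m}" for i
  proof -
    obtain c' where "((\<lambda>x. x powr k i * \<P>(\<omega> in M. W i 1 \<omega> > x)) \<longlongrightarrow> c') at_top"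
      using tail[of i] i unfolding has_tail_index_iff by blast
    then show ?thesis using least i by (intro powr_tail_lighter) auto
  qed
  have "indep_vars (\<lambda>_. borel) (\<lambda>i \<omega>. (\<lambda>y. y 1) (\<lambda>n\<in>{1..}. W i n \<omega>)) I"
    using indep unfolding indep_seqs_def
    by (rule indep_vars_compose2[where Y = "\<lambda>_ y. y 1"]) (rule measurable_component_singleton, simp)
  then have marg: "indep_vars (\<lambda>_. borel) (\<lambda>i. W i 1) I" by simp
  have pair: "indep_var borel (W m 1) borel (W i 1)" if "i \<in> I - {m}" for i
    using indep_vars_sum[OF finite.intros(2)[OF finite.intros(1)], of m i "\<lambda>i. W i 1"]
      indep_vars_subset[OF marg, of "{m, i}"] that I(2) by auto
  have diff: "((\<lambda>x. x powr k m * \<P>(\<omega> in M. (S 1 \<omega> > x) \<noteq> (W m 1 \<omega> > x))) \<longlongrightarrow> 0) at_top"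
  proof (rule exceedance_diff_negligible[where W = "\<lambda>i. W i 1" and I = I, OF M I _ _ lim light pair])
    show "W i 1 \<in> borel_measurable M" if "i \<in> I" for i
      using st[OF that] by (rule stationary_seq_measurable) simp
    show "S 1 \<in> borel_measurable M"
      using stS by (rule stationary_seq_measurable) simp
    have restr: "(\<Sum>i\<in>I - {m}. max 0 (h (restrict w I i))) = (\<Sum>i\<in>I - {m}. max 0 (h (w i)))"
      for w :: "nat \<Rightarrow> real" and h :: "real \<Rightarrow> real"
      by (intro sum.cong) auto
    show "S 1 \<omega> \<le> max 0 (W m 1 \<omega>) + (\<Sum>i\<in>I - {m}. max 0 (W i 1 \<omega>))" for \<omega>
      using upper[of "\<lambda>i\<in>I. W i 1 \<omega>"] I(2) restr[of "\<lambda>x. x"] by (simp add: S_def)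
    show "W m 1 \<omega> - (\<Sum>i\<in>I - {m}. max 0 (- W i 1 \<omega>)) \<le> S 1 \<omega>" for \<omega>
      using lower[of "\<lambda>i\<in>I. W i 1 \<omega>"] I(2) restr[of uminus] by (simp add: S_def)
  qed
  show "has_tail_index M (\<lambda>n \<omega>. f (\<lambda>i\<in>I. W i n \<omega>)) (k m)"
    using indices_transfer(1)[OF M tail[OF I(2)] stS same diff] unfolding S_def .
  show "has_extremal_index M (\<lambda>n \<omega>. f (\<lambda>i\<in>I. W i n \<omega>)) \<theta>"
    using indices_transfer(2)[OF M tail[OF I(2)] stS same diff ext] unfolding S_def .
qed

text \<open>
  In the upper bound \<open>w m\<close> enters through its positive part only: a maximum can exceed \<open>w m\<close> plus the
  other positive parts when \<open>w m\<close> is very negative.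
\<close>

lemma Max_dominated:
  fixes w :: "'i \<Rightarrow> real"
  assumes I: "finite I" "m \<in> I"
  shows "Max (w ` I) \<le> max 0 (w m) + (\<Sum>i\<in>I - {m}. max 0 (w i))"
    and "w m - (\<Sum>i\<in>I - {m}. max 0 (- w i)) \<le> Max (w ` I)"
proof -
  have "w j \<le> max 0 (w m) + (\<Sum>i\<in>I - {m}. max 0 (w i))" if "j \<in> I" for j
  proof -
    have "w j \<le> (\<Sum>i\<in>I. max 0 (w i))"
      using member_le_sum[of j I "\<lambda>i. max 0 (w i)"] that I by auto
    then show ?thesis using I by (simp add: sum.remove)
  qed
  then show "Max (w ` I) \<le> max 0 (w m) + (\<Sum>i\<in>I - {m}. max 0 (w i))"
    using I by (intro Max.boundedI) auto
  have "w m \<le> Max (w ` I)" using I by auto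
  moreover have "(\<Sum>i\<in>I - {m}. max 0 (- w i)) \<ge> 0" by (intro sum_nonneg) auto
  ultimately show "w m - (\<Sum>i\<in>I - {m}. max 0 (- w i)) \<le> Max (w ` I)" by linarith
qed

lemma sum_dominated:
  fixes w :: "'i \<Rightarrow> real"
  assumes I: "finite I" "m \<in> I"
  shows "sum w I \<le> max 0 (w m) + (\<Sum>i\<in>I - {m}. max 0 (w i))"
    and "w m - (\<Sum>i\<in>I - {m}. max 0 (- w i)) \<le> sum w I"
proof -
  have eq: "sum w I = w m + sum w (I - {m})" using I by (rule sum.remove)
  show "sum w I \<le> max 0 (w m) + (\<Sum>i\<in>I - {m}. max 0 (w i))"
    unfolding eq by (intro add_mono sum_mono) auto
  have "- (\<Sum>i\<in>I - {m}. max 0 (- w i)) = (\<Sum>i\<in>I - {m}. - max 0 (- w i))"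
    by (simp add: sum_negf)
  also have "\<dots> \<le> sum w (I - {m})" by (intro sum_mono) auto
  finally show "w m - (\<Sum>i\<in>I - {m}. max 0 (- w i)) \<le> sum w I" unfolding eq by linarith
qed

lemma indep_seqs_scale:
  assumes M: "prob_space M" and "indep_seqs M Y I"
  shows "indep_seqs M (\<lambda>i n \<omega>. z i * Y i n \<omega>) I"
proof -
  interpret prob_space M by (rule M)
  let ?P = "Pi\<^sub>M {1::nat..} (\<lambda>_. borel :: real measure)"
  let ?h = "\<lambda>i y. \<lambda>n\<in>{1::nat..}. z i * y n"
  have "indep_vars (\<lambda>_. ?P) (\<lambda>i \<omega>. ?h i (\<lambda>n\<in>{1..}. Y i n \<omega>)) I"
    using assms(2) unfolding indep_seqs_def
  proof (rule indep_vars_compose2[where Y = ?h])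
    show "?h i \<in> measurable ?P ?P" for i
      by (intro measurable_restrict borel_measurable_times borel_measurable_const
            measurable_component_singleton) auto
  qed
  also have "(\<lambda>i \<omega>. ?h i (\<lambda>n\<in>{1..}. Y i n \<omega>)) = (\<lambda>i \<omega>. \<lambda>n\<in>{1..}. z i * Y i n \<omega>)"
    by (intro ext restrict_ext) auto
  finally show ?thesis unfolding indep_seqs_def .
qed

theorem theorem3:
  fixes M :: "'a measure"
    and l m :: nat
    and z k \<theta> :: "nat \<Rightarrow> real"
    and Y :: "nat \<Rightarrow> nat \<Rightarrow> 'a \<Rightarrow> real"
  assumes "prob_space M"
    and "l \<ge> 1"
    and "\<And>i. i \<in> {1..l} \<Longrightarrow> z i > 0"
    and "indep_seqs M Y {1..l}"
    and "\<And>i. i \<in> {1..l} \<Longrightarrow> stationary_seq M (Y i)"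
    and "\<And>i. i \<in> {1..l} \<Longrightarrow> has_tail_index M (Y i) (k i)"
    and "\<And>i. i \<in> {1..l} \<Longrightarrow> has_extremal_index M (Y i) (\<theta> i)"
    and "m \<in> {1..l}"
    and "\<And>i. i \<in> {1..l} \<Longrightarrow> i \<noteq> m \<Longrightarrow> k m < k i"
  shows "has_tail_index M (\<lambda>n \<omega>. Max ((\<lambda>i. z i * Y i n \<omega>) ` {1..l})) (k m)
       \<and> has_tail_index M (\<lambda>n \<omega>. \<Sum>i=1..l. z i * Y i n \<omega>) (k m)
       \<and> has_extremal_index M (\<lambda>n \<omega>. Max ((\<lambda>i. z i * Y i n \<omega>) ` {1..l})) (\<theta> m)
       \<and> has_extremal_index M (\<lambda>n \<omega>. \<Sum>i=1..l. z i * Y i n \<omega>) (\<theta> m)"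
proof -
  let ?I = "{1..l}" and ?W = "\<lambda>i n \<omega>. z i * Y i n \<omega>"
  have indep: "indep_seqs M ?W ?I"
    using assms(1,4) by (rule indep_seqs_scale)
  have tail: "has_tail_index M (?W i) (k i)" if "i \<in> ?I" for i
    using assms(6)[OF that] assms(3)[OF that] by (rule has_tail_index_scale)
  have ext: "has_extremal_index M (?W m) (\<theta> m)"
    using assms(1) assms(7)[OF assms(8)] assms(3)[OF assms(8)] by (rule has_extremal_index_scale)
  have dominated: "has_tail_index M (\<lambda>n \<omega>. f (\<lambda>i\<in>?I. ?W i n \<omega>)) (k m)
      \<and> has_extremal_index M (\<lambda>n \<omega>. f (\<lambda>i\<in>?I. ?W i n \<omega>)) (\<theta> m)"
    if "f \<in> borel_measurable (Pi\<^sub>M ?I (\<lambda>_. borel))"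
      and "\<And>w. f w \<le> max 0 (w m) + (\<Sum>i\<in>?I - {m}. max 0 (w i))"
      and "\<And>w. w m - (\<Sum>i\<in>?I - {m}. max 0 (- w i)) \<le> f w" for f
    using dominated_combination[where W = ?W and k = k and f = f,
        OF assms(1) finite_atLeastAtMost assms(8) indep _ ext _ that] tail assms(9) by blast
  have Max: "has_tail_index M (\<lambda>n \<omega>. Max ((\<lambda>i\<in>?I. ?W i n \<omega>) ` ?I)) (k m)
      \<and> has_extremal_index M (\<lambda>n \<omega>. Max ((\<lambda>i\<in>?I. ?W i n \<omega>) ` ?I)) (\<theta> m)"
  proof (rule dominated[OF _ Max_dominated[OF finite_atLeastAtMost assms(8)]])
    show "(\<lambda>w. Max (w ` ?I)) \<in> borel_measurable (Pi\<^sub>M ?I (\<lambda>_. borel :: real measure))"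
      using assms(2) by (intro borel_measurable_Max measurable_component_singleton) auto
  qed
  have sum: "has_tail_index M (\<lambda>n \<omega>. sum (\<lambda>i\<in>?I. ?W i n \<omega>) ?I) (k m)
      \<and> has_extremal_index M (\<lambda>n \<omega>. sum (\<lambda>i\<in>?I. ?W i n \<omega>) ?I) (\<theta> m)"
  proof (rule dominated[OF _ sum_dominated[OF finite_atLeastAtMost assms(8)]])
    show "(\<lambda>w. sum w ?I) \<in> borel_measurable (Pi\<^sub>M ?I (\<lambda>_. borel :: real measure))"
      by (intro borel_measurable_sum measurable_component_singleton) auto
  qed
  \<comment> \<open>The restriction to the index set disappears under the maximum and the sum.\<close>
  have 1: "(\<lambda>i\<in>?I. ?W i n \<omega>) ` ?I = (\<lambda>i. ?W i n \<omega>) ` ?I" for n \<omega>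
    by (intro image_cong) auto
  have 2: "sum (\<lambda>i\<in>?I. ?W i n \<omega>) ?I = (\<Sum>i=1..l. ?W i n \<omega>)" for n \<omega>
    by (intro sum.cong) auto
  show ?thesis using Max sum unfolding 1 2 by blast
qed

end
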